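(* The mesh patterns $$p=(132,\{(0,2),(1,0),(1,1),(1,3),(2,1),(2,3)\})\quad\text{and}\quad q=(132,\{(0,2),(1,0),(1,1),(1,3),(2,1),(2,2),(2,3)\})$$ are coincident, i.e. a permutation avoids $p$ if and only if it avoids $q$.
   Context: A permutation of size $n$ is a bijection of $\{1,\dots,n\}$, written as a word $\pi(1)\cdots\pi(n)$. A mesh pattern is a pair $(\tau,R)$ with $\tau\in S_k$ and $R\subseteq\{0,\dots,k\}^2$, where $(a,b)$ stands for the unit square $[a,a+1]\times[b,b+1]$ (shaded). A permutation $\pi\in S_n$ contains $(\tau,R)$ if there are indices $u_1<\dots<u_k$ such that $\pi(u_1)\cdots\pi(u_k)$ is order isomorphic to $\tau$ and, writing $v_1<\dots<v_k$ for the sorted values of this subsequence, $u_0=v_0=0$, $u_{k+1}=v_{k+1}=n+1$, for every $(a,b)\in R$ there is no index $x$ with $u_a<x<u_{a+1}$ and $v_b<\pi(x)<v_{b+1}$. Otherwise $\pi$ avoids $(\tau,R)$. Two patterns are coincident if they are avoided by exactly the same permutations (of all sizes). *)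

theory Defs
  imports "HOL-Combinatorics.Permutations"
begin

text \<open>A permutation of size \<open>n\<close> is a function \<open>\<pi>\<close> with \<open>\<pi> permutes {1..n}\<close>; hence it is the identity
  outside \<open>{1..n}\<close>. One-line notation is 1-based.\<close>

definition perm_of_word :: "nat list \<Rightarrow> nat \<Rightarrow> nat" where
  "perm_of_word w i = (if i \<in> {1..length w} then w ! (i - 1) else i)"

text \<open>The triple \<open>(k, \<tau>, R)\<close> stands for the mesh pattern \<open>(\<tau>, R)\<close> with \<open>\<tau>\<close> of size \<open>k\<close>; the size has to
  be recorded because it cannot be read off from the function \<open>\<tau>\<close>.\<close>

type_synonym mesh_pattern = "nat \<times> (nat \<Rightarrow> nat) \<times> (nat \<times> nat) set"

fun is_mesh_pattern :: "mesh_pattern \<Rightarrow> bool" where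
  "is_mesh_pattern (k, \<tau>, R) \<longleftrightarrow> \<tau> permutes {1..k} \<and> R \<subseteq> {0..k} \<times> {0..k}"

text \<open>In \<open>mesh_occurrence n \<pi> (k, \<tau>, R) u v\<close>, \<open>u\<close> lists the positions of the occurrence and \<open>v\<close> its values
  in increasing order, both extended by the conventional entries at \<open>0\<close> and \<open>k + 1\<close>.\<close>

fun mesh_occurrence ::
  "nat \<Rightarrow> (nat \<Rightarrow> nat) \<Rightarrow> mesh_pattern \<Rightarrow> (nat \<Rightarrow> nat) \<Rightarrow> (nat \<Rightarrow> nat) \<Rightarrow> bool" where
  "mesh_occurrence n \<pi> (k, \<tau>, R) u v \<longleftrightarrow>
     u ` {1..k} \<subseteq> {1..n} \<and> strict_mono_on {1..k} u \<and>
     (\<forall>i\<in>{1..k}. \<forall>j\<in>{1..k}. \<pi> (u i) < \<pi> (u j) \<longleftrightarrow> \<tau> i < \<tau> j) \<and>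
     v ` {1..k} = \<pi> ` u ` {1..k} \<and> strict_mono_on {1..k} v \<and>
     u 0 = 0 \<and> v 0 = 0 \<and> u (k + 1) = n + 1 \<and> v (k + 1) = n + 1 \<and>
     (\<forall>(a, b)\<in>R. \<not> (\<exists>x\<in>{1..n}. u a < x \<and> x < u (a + 1) \<and> v b < \<pi> x \<and> \<pi> x < v (b + 1)))"

definition mesh_contains :: "nat \<Rightarrow> (nat \<Rightarrow> nat) \<Rightarrow> mesh_pattern \<Rightarrow> bool" where
  "mesh_contains n \<pi> p \<longleftrightarrow> (\<exists>u v. mesh_occurrence n \<pi> p u v)"

definition mesh_avoids :: "nat \<Rightarrow> (nat \<Rightarrow> nat) \<Rightarrow> mesh_pattern \<Rightarrow> bool" where
  "mesh_avoids n \<pi> p \<longleftrightarrow> \<not> mesh_contains n \<pi> p"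

definition coincident :: "mesh_pattern \<Rightarrow> mesh_pattern \<Rightarrow> bool" where
  "coincident p q \<longleftrightarrow> (\<forall>n \<pi>. \<pi> permutes {1..n} \<longrightarrow> (mesh_avoids n \<pi> p \<longleftrightarrow> mesh_avoids n \<pi> q))"

definition pattern_p :: mesh_pattern where
  "pattern_p = (3, perm_of_word [1, 3, 2], {(0,2), (1,0), (1,1), (1,3), (2,1), (2,3)})"

definition pattern_q :: mesh_pattern where
  "pattern_q = (3, perm_of_word [1, 3, 2], {(0,2), (1,0), (1,1), (1,3), (2,1), (2,2), (2,3)})"

lemma perm_of_word_permutes:
  assumes "distinct w" and "set w = {1..length w}"
  shows "perm_of_word w permutes {1..length w}"
proof (rule bij_imp_permutes)
  have "inj_on (perm_of_word w) {1..length w}"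
    using assms(1) by (auto simp: inj_on_def perm_of_word_def nth_eq_iff_index_eq)
  moreover have "perm_of_word w ` {1..length w} \<subseteq> {1..length w}"
    using assms(2) nth_mem[of _ w] by (fastforce simp: perm_of_word_def)
  ultimately show "bij_betw (perm_of_word w) {1..length w} {1..length w}"
    by (simp add: bij_betw_def endo_inj_surj)
qed (auto simp: perm_of_word_def)

lemma is_mesh_pattern_p: "is_mesh_pattern pattern_p"
  and is_mesh_pattern_q: "is_mesh_pattern pattern_q"
proof -
  have "perm_of_word [1, 3, 2] permutes {1..length [1, 3, 2 :: nat]}"
    by (rule perm_of_word_permutes) (simp, force)
  then show "is_mesh_pattern pattern_p" "is_mesh_pattern pattern_q"
    by (simp_all add: pattern_p_def pattern_q_def numeral_eq_Suc)
qed

end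

theory Submission
  imports Defs
begin

text \<open>Shading more squares can only make a pattern easier to avoid, so what has to be shown is that a
  permutation containing \<open>p\<close> contains \<open>q\<close>. Call a triple of positions \<open>A < B < C\<close> with
  \<open>\<pi> A < \<pi> C < \<pi> B\<close> an occurrence of the underlying pattern 132, and suppose that it respects the
  shading of \<open>p\<close>. If it violates the shading of \<open>q\<close>, then some point \<open>D\<close> lies in the square \<open>(2,2)\<close>.

  Read from left to right the point at \<open>A\<close> followed by all points strictly between the columns of \<open>A\<close>
  and \<open>C\<close> that are higher than \<open>\<pi> C\<close>. The resulting word has a descent, because \<open>D\<close> comes after \<open>B\<close> and
  is lower. Let \<open>F\<close>, \<open>E\<close> be its first descent, so that the word increases up to \<open>F\<close>, and let \<open>G\<close> be its
  last entry before \<open>E\<close> that is lower than \<open>E\<close>; it exists since \<open>A\<close> starts the word and is lower than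
  all its other entries. Then \<open>G, F, E\<close> is an occurrence of \<open>q\<close>. No entry of the word lies in one of
  its shaded squares, by the choice of \<open>E\<close>, \<open>F\<close> and \<open>G\<close>. The points between the columns of \<open>A\<close> and
  \<open>C\<close> that do not belong to the word are, by the shading of \<open>p\<close>, lower than \<open>A\<close> and to the right of \<open>B\<close>;
  the first descent starts no later than at \<open>B\<close>, the highest entry, so such points only fall into
  the unshaded square \<open>(2,0)\<close> of the new occurrence or to the right of it. The points to the left of
  \<open>A\<close> are excluded from the new square \<open>(0,2)\<close> because its rows lie within those of the old one.\<close>

section \<open>Occurrences of 132 as triples of positions\<close>

definition empty_box :: "nat \<Rightarrow> (nat \<Rightarrow> nat) \<Rightarrow> nat \<Rightarrow> nat \<Rightarrow> nat \<Rightarrow> nat \<Rightarrow> bool" where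
  "empty_box n \<pi> l r d t \<longleftrightarrow> \<not> (\<exists>x\<in>{1..n}. l < x \<and> x < r \<and> d < \<pi> x \<and> \<pi> x < t)"

lemma empty_boxD:
  assumes "empty_box n \<pi> l r d t" "x \<in> {1..n}" "l < x" "x < r"
  shows "\<pi> x \<le> d \<or> t \<le> \<pi> x"
  using assms unfolding empty_box_def by force

text \<open>The values of an occurrence are determined by its positions: for 132 their increasing order
  is first, third, second. This turns a containment into a statement about three positions.\<close>

lemma mesh_contains_132_iff:
  assumes R: "R \<subseteq> {0..3} \<times> {0..3}"
  shows "mesh_contains n \<pi> (3, perm_of_word [1, 3, 2], R) \<longleftrightarrow>
    (\<exists>A B C. 1 \<le> A \<and> A < B \<and> B < C \<and> C \<le> n \<and> \<pi> A < \<pi> C \<and> \<pi> C < \<pi> B \<and>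
      (\<forall>(a, b)\<in>R. empty_box n \<pi> ([0, A, B, C, n + 1] ! a) ([0, A, B, C, n + 1] ! (a + 1))
         ([0, \<pi> A, \<pi> C, \<pi> B, n + 1] ! b) ([0, \<pi> A, \<pi> C, \<pi> B, n + 1] ! (b + 1))))"
    (is "_ \<longleftrightarrow> (\<exists>A B C. ?occ A B C)")
proof
  have set3: "{1..3} = {1, 2, 3::nat}" by auto
  have word: "perm_of_word [1, 3, 2] 1 = 1" "perm_of_word [1, 3, 2] 2 = 3"
    "perm_of_word [1, 3, 2] 3 = 2"
    by (simp_all add: perm_of_word_def)
  {
    assume "mesh_contains n \<pi> (3, perm_of_word [1, 3, 2], R)"
    then obtain u v where occ: "mesh_occurrence n \<pi> (3, perm_of_word [1, 3, 2], R) u v"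
      by (auto simp: mesh_contains_def)
    note occ_unfolded = occ[unfolded mesh_occurrence.simps set3]
    have u: "1 \<le> u 1" "u 1 < u 2" "u 2 < u 3" "u 3 \<le> n" "u 0 = 0" "u 4 = n + 1"
      using occ_unfolded by (simp_all add: strict_mono_on_def)
    have \<pi>u: "\<pi> (u 1) < \<pi> (u 3)" "\<pi> (u 3) < \<pi> (u 2)"
      using occ_unfolded word by simp_all
    have v: "v 1 < v 2" "v 2 < v 3" "v 0 = 0" "v 4 = n + 1"
      using occ_unfolded by (simp_all add: strict_mono_on_def)
    have "{v 1, v 2, v 3} = {\<pi> (u 1), \<pi> (u 2), \<pi> (u 3)}"
      using occ_unfolded by simp
    then have "v 1 \<in> {\<pi> (u 1), \<pi> (u 2), \<pi> (u 3)}" "v 2 \<in> {\<pi> (u 1), \<pi> (u 2), \<pi> (u 3)}"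
      "v 3 \<in> {\<pi> (u 1), \<pi> (u 2), \<pi> (u 3)}"
      by blast+
    then have "v 1 = \<pi> (u 1) \<and> v 2 = \<pi> (u 3) \<and> v 3 = \<pi> (u 2)"
      using v(1,2) \<pi>u by auto
    then have v1: "v 1 = \<pi> (u 1)" and v2: "v 2 = \<pi> (u 3)" and v3: "v 3 = \<pi> (u 2)"
      by blast+
    have u_nth: "u i = [0, u 1, u 2, u 3, n + 1] ! i"
      and v_nth: "v i = [0, \<pi> (u 1), \<pi> (u 3), \<pi> (u 2), n + 1] ! i" if "i \<le> 4" for i
    proof -
      have "i = 0 \<or> i = 1 \<or> i = 2 \<or> i = 3 \<or> i = 4" using that by auto
      then show "u i = [0, u 1, u 2, u 3, n + 1] ! i"
        and "v i = [0, \<pi> (u 1), \<pi> (u 3), \<pi> (u 2), n + 1] ! i"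
        by (auto simp: u(5,6) v(3,4) v1[simplified] v2[simplified] v3[simplified])
    qed
    have "?occ (u 1) (u 2) (u 3)"
    proof (intro conjI ballI, goal_cases)
      case (7 r)
      obtain a b where r: "r = (a, b)" by (cases r)
      with 7 R have "a \<le> 3" "b \<le> 3" by auto
      then have le: "a \<le> 4" "a + 1 \<le> 4" "b \<le> 4" "b + 1 \<le> 4" by auto
      have "empty_box n \<pi> (u a) (u (a + 1)) (v b) (v (b + 1))"
        using occ_unfolded 7 r unfolding empty_box_def by blast
      then show ?case
        unfolding r prod.case u_nth[OF le(1)] u_nth[OF le(2)] v_nth[OF le(3)] v_nth[OF le(4)] .
    qed (use u \<pi>u in auto)
    then show "\<exists>A B C. ?occ A B C" by blast
  }
  {
    assume "\<exists>A B C. ?occ A B C"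
    then obtain A B C where occ: "?occ A B C" by blast
    have "mesh_occurrence n \<pi> (3, perm_of_word [1, 3, 2], R)
        (\<lambda>i. [0, A, B, C, n + 1] ! i) (\<lambda>i. [0, \<pi> A, \<pi> C, \<pi> B, n + 1] ! i)"
      unfolding mesh_occurrence.simps empty_box_def[symmetric] set3
    proof (intro conjI, goal_cases)
      case 10
      show ?case using occ by blast
    qed (use occ in \<open>auto simp: strict_mono_on_def perm_of_word_def\<close>)
    then show "mesh_contains n \<pi> (3, perm_of_word [1, 3, 2], R)"
      unfolding mesh_contains_def by blast
  }
qed

section \<open>From the smaller shading to the larger one\<close>

text \<open>The two hypotheses on points between \<open>A\<close> and \<open>C\<close> are the squares \<open>(1,0)\<close>, \<open>(1,1)\<close>, \<open>(2,1)\<close>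
  (such a point is higher than \<open>C\<close>, or lower than \<open>A\<close> and to the right of \<open>B\<close>) and \<open>(1,3)\<close>, \<open>(2,3)\<close>
  (none is higher than \<open>B\<close>). The three conclusions on points say that the new occurrence has nothing
  in square \<open>(0,2)\<close>, in column 1 only points in square \<open>(1,2)\<close>, and in column 2 only points in
  square \<open>(2,0)\<close>.\<close>

lemma first_descent_occurrence:
  fixes \<pi> :: "nat \<Rightarrow> nat"
  assumes inj: "inj \<pi>"
    and pos: "A < B" "B < C" and val: "\<pi> A < \<pi> C" "\<pi> C < \<pi> B"
    and left: "\<And>x. 0 < x \<Longrightarrow> x < A \<Longrightarrow> \<pi> C < \<pi> x \<Longrightarrow> \<pi> x < \<pi> B \<Longrightarrow> False"
    and low: "\<And>x. A < x \<Longrightarrow> x < C \<Longrightarrow> \<pi> x \<le> \<pi> C \<Longrightarrow> B < x \<and> \<pi> x < \<pi> A"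
    and high: "\<And>x. A < x \<Longrightarrow> x < C \<Longrightarrow> \<pi> x \<le> \<pi> B"
    and D: "B < D" "D < C" "\<pi> C < \<pi> D"
  obtains G F E where "A \<le> G" "G < F" "F < E" "E < C" "\<pi> G < \<pi> E" "\<pi> E < \<pi> F"
    and "\<And>x. 0 < x \<Longrightarrow> x < G \<Longrightarrow> \<pi> E < \<pi> x \<Longrightarrow> \<pi> x < \<pi> F \<Longrightarrow> False"
    and "\<And>x. G < x \<Longrightarrow> x < F \<Longrightarrow> \<pi> E \<le> \<pi> x \<and> \<pi> x \<le> \<pi> F"
    and "\<And>x. F < x \<Longrightarrow> x < E \<Longrightarrow> \<pi> x < \<pi> G"
proof -
  (* The points of the word, and the position at which its first descent ends. *)
  define S where "S = {x. x = A \<or> A < x \<and> x < C \<and> \<pi> C < \<pi> x}"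
  define E where "E = (LEAST x. x \<in> S \<and> (\<exists>y\<in>S. y < x \<and> \<pi> x < \<pi> y))"
  have "\<pi> D \<noteq> \<pi> B"
    using inj_eq[OF inj] D(1) by simp
  then have "\<pi> D < \<pi> B"
    using high[of D] D pos by fastforce
  then have "D \<in> S \<and> (\<exists>y\<in>S. y < D \<and> \<pi> D < \<pi> y)"
    using D pos val by (auto simp: S_def intro!: bexI[of _ B])
  then have E: "E \<in> S \<and> (\<exists>y\<in>S. y < E \<and> \<pi> E < \<pi> y)"
    unfolding E_def by (rule LeastI)
  then obtain y where y: "y \<in> S" "y < E" "\<pi> E < \<pi> y" by blast
  have incr: "\<pi> x < \<pi> z" if "x \<in> S" "z \<in> S" "x < z" "z < E" for x z
  proof -
    have "\<not> \<pi> z < \<pi> x"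
      using not_less_Least[of z "\<lambda>x. x \<in> S \<and> (\<exists>y\<in>S. y < x \<and> \<pi> x < \<pi> y)"] that
      unfolding E_def[symmetric] by blast
    moreover have "\<pi> x \<noteq> \<pi> z" using inj_eq[OF inj] that(3) by simp
    ultimately show ?thesis by simp
  qed
  have E_gt: "A < E" and E_lt: "E < C" and E_val: "\<pi> C < \<pi> E"
    using E y unfolding S_def by auto
  have "\<pi> A < \<pi> E" using E_val val by simp

  define F where "F = Max {x \<in> S. x < E}"
  have "finite {x \<in> S. x < E}" by simp
  then have F: "F \<in> S" "F < E" and F_max: "\<And>x. x \<in> S \<Longrightarrow> x < E \<Longrightarrow> x \<le> F"
    using Max_in[of "{x \<in> S. x < E}", folded F_def] Max_ge[of "{x \<in> S. x < E}", folded F_def] y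
    by blast+
  have "\<pi> y \<le> \<pi> F"
    using incr[OF y(1) F(1) _ F(2)] F_max[OF y(1,2)] by fastforce
  then have EF: "\<pi> E < \<pi> F" using y(3) by simp

  define G where "G = Max {x \<in> S. x < E \<and> \<pi> x < \<pi> E}"
  have "A \<in> {x \<in> S. x < E \<and> \<pi> x < \<pi> E}"
    using E_gt \<open>\<pi> A < \<pi> E\<close> by (simp add: S_def)
  moreover have "finite {x \<in> S. x < E \<and> \<pi> x < \<pi> E}" by simp
  ultimately have G: "G \<in> S" "G < E" "\<pi> G < \<pi> E"
    and G_max: "\<And>x. x \<in> S \<Longrightarrow> x < E \<Longrightarrow> \<pi> x < \<pi> E \<Longrightarrow> x \<le> G"
    using Max_in[of "{x \<in> S. x < E \<and> \<pi> x < \<pi> E}", folded G_def]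
      Max_ge[of "{x \<in> S. x < E \<and> \<pi> x < \<pi> E}", folded G_def] by blast+
  have GF: "G < F"
    using F_max[OF G(1,2)] G(3) EF by (cases "G = F") auto
  have AG: "A \<le> G" and AG_val: "\<pi> A \<le> \<pi> G"
    using G(1) val by (auto simp: S_def)
  have AF: "A < F" "F < C" and F_val: "\<pi> F \<le> \<pi> B"
    using AG GF F E_lt high[of F] by auto

  (* B is a highest entry of S, so an increasing run of S cannot continue beyond it. *)
  have FB: "F \<le> B"
  proof (rule ccontr)
    assume "\<not> F \<le> B"
    moreover have "B \<in> S" using pos val by (simp add: S_def)
    ultimately have "\<pi> B < \<pi> F" using incr F by simp
    with F_val show False by simp
  qed
  have in_S: "x \<in> S" if "A < x" "x < C" "x \<le> B \<or> \<pi> A \<le> \<pi> x" for x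
    using low[of x] that by (cases "\<pi> C < \<pi> x") (auto simp: S_def)

  show ?thesis
  proof (rule that[OF AG GF F(2) E_lt G(3) EF], goal_cases)
    case (1 x)
    have "x < A \<or> x = A \<or> x \<in> S"
      using in_S[of x] 1 GF AF FB by linarith
    then show False
    proof (elim disjE)
      assume "x < A"
      show False
        by (rule left[of x]) (use 1 \<open>x < A\<close> E_val F_val in linarith)+
    next
      assume "x = A"
      then show False using 1 \<open>\<pi> A < \<pi> E\<close> by simp
    next
      assume "x \<in> S"
      then have "\<pi> x < \<pi> G" using incr[OF _ G(1) _ G(2)] 1 by blast
      then show False using 1 G(3) by simp
    qed
  next
    case (2 x)
    then have x: "x \<in> S" "x < E"
      using in_S[of x] AG AF FB F(2) by auto
    have "\<not> \<pi> x < \<pi> E" using G_max[OF x] 2 by auto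
    moreover have "\<pi> x < \<pi> F" using incr[OF x(1) F(1) _ F(2)] 2 by blast
    ultimately show ?case by simp
  next
    case (3 x)
    have "x \<notin> S" using F_max[of x] 3 by auto
    then have "\<pi> x < \<pi> A"
      using in_S[of x] 3 AF E_lt by linarith
    then show ?case using AG_val by simp
  qed
qed

lemma mesh_contains_p_imp_q:
  assumes perm: "\<pi> permutes {1..n}" and p: "mesh_contains n \<pi> pattern_p"
  shows "mesh_contains n \<pi> pattern_q"
proof -
  have inj: "inj \<pi>" using permutes_inj[OF perm] .
  have range: "1 \<le> \<pi> x \<and> \<pi> x \<le> n" if "x \<in> {1..n}" for x
    using permutes_in_image[OF perm, of x] that by simp
  have p_iff: "mesh_contains n \<pi> pattern_p \<longleftrightarrow>
    (\<exists>A B C. 1 \<le> A \<and> A < B \<and> B < C \<and> C \<le> n \<and> \<pi> A < \<pi> C \<and> \<pi> C < \<pi> B \<and>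
      empty_box n \<pi> 0 A (\<pi> C) (\<pi> B) \<and>
      empty_box n \<pi> A B 0 (\<pi> A) \<and>
      empty_box n \<pi> A B (\<pi> A) (\<pi> C) \<and>
      empty_box n \<pi> A B (\<pi> B) (n + 1) \<and>
      empty_box n \<pi> B C (\<pi> A) (\<pi> C) \<and>
      empty_box n \<pi> B C (\<pi> B) (n + 1))"
    unfolding pattern_p_def by (subst mesh_contains_132_iff) (simp_all add: numeral_eq_Suc)
  have q_iff: "mesh_contains n \<pi> pattern_q \<longleftrightarrow>
    (\<exists>A B C. 1 \<le> A \<and> A < B \<and> B < C \<and> C \<le> n \<and> \<pi> A < \<pi> C \<and> \<pi> C < \<pi> B \<and>
      empty_box n \<pi> 0 A (\<pi> C) (\<pi> B) \<and>
      empty_box n \<pi> A B 0 (\<pi> A) \<and>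
      empty_box n \<pi> A B (\<pi> A) (\<pi> C) \<and>
      empty_box n \<pi> A B (\<pi> B) (n + 1) \<and>
      empty_box n \<pi> B C (\<pi> A) (\<pi> C) \<and>
      empty_box n \<pi> B C (\<pi> C) (\<pi> B) \<and>
      empty_box n \<pi> B C (\<pi> B) (n + 1))"
    unfolding pattern_q_def by (subst mesh_contains_132_iff) (simp_all add: numeral_eq_Suc)
  obtain A B C where pos: "1 \<le> A" "A < B" "B < C" "C \<le> n" and val: "\<pi> A < \<pi> C" "\<pi> C < \<pi> B"
    and p02: "empty_box n \<pi> 0 A (\<pi> C) (\<pi> B)"
    and p10: "empty_box n \<pi> A B 0 (\<pi> A)"
    and p11: "empty_box n \<pi> A B (\<pi> A) (\<pi> C)"
    and p13: "empty_box n \<pi> A B (\<pi> B) (n + 1)"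
    and p21: "empty_box n \<pi> B C (\<pi> A) (\<pi> C)"
    and p23: "empty_box n \<pi> B C (\<pi> B) (n + 1)"
    using p unfolding p_iff by blast
  show ?thesis
  proof (cases "empty_box n \<pi> B C (\<pi> C) (\<pi> B)")
    case True
    then show ?thesis
      unfolding q_iff using pos val p02 p10 p11 p13 p21 p23 by blast
  next
    case False
    then obtain D where D: "B < D" "D < C" "\<pi> C < \<pi> D" by (auto simp: empty_box_def)
    have left: False if "0 < x" "x < A" "\<pi> C < \<pi> x" "\<pi> x < \<pi> B" for x
      using p02 that pos by (auto simp: empty_box_def)
    have low: "B < x \<and> \<pi> x < \<pi> A" if x: "A < x" "x < C" "\<pi> x \<le> \<pi> C" for x
    proof -
      have xn: "x \<in> {1..n}" using x pos by auto
      have ne: "\<pi> x \<noteq> \<pi> A" "\<pi> x \<noteq> \<pi> C" using inj_eq[OF inj] x by auto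
      have "x \<noteq> B" using x val by auto
      moreover have "\<not> x < B"
        using empty_boxD[OF p10 xn x(1)] empty_boxD[OF p11 xn x(1)] range[OF xn] x ne by linarith
      ultimately show ?thesis
        using empty_boxD[OF p21 xn _ x(2)] x ne by linarith
    qed
    have high: "\<pi> x \<le> \<pi> B" if x: "A < x" "x < C" for x
    proof -
      have xn: "x \<in> {1..n}" using x pos by auto
      show ?thesis
        using empty_boxD[OF p13 xn x(1)] empty_boxD[OF p23 xn _ x(2)] range[OF xn]
        by (cases x B rule: linorder_cases) auto
    qed
    obtain G F E where q: "A \<le> G" "G < F" "F < E" "E < C" "\<pi> G < \<pi> E" "\<pi> E < \<pi> F"
      and q0: "\<And>x. 0 < x \<Longrightarrow> x < G \<Longrightarrow> \<pi> E < \<pi> x \<Longrightarrow> \<pi> x < \<pi> F \<Longrightarrow> False"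
      and q1: "\<And>x. G < x \<Longrightarrow> x < F \<Longrightarrow> \<pi> E \<le> \<pi> x \<and> \<pi> x \<le> \<pi> F"
      and q2: "\<And>x. F < x \<Longrightarrow> x < E \<Longrightarrow> \<pi> x < \<pi> G"
    proof (rule first_descent_occurrence[OF inj pos(2,3) val _ _ _ D], goal_cases)
      case (1 x)
      from 1(2-) show ?case by (rule left)
    next
      case (2 x)
      from 2(2-) show ?case by (rule low)
    next
      case (3 x)
      from 3(2-) show ?case by (rule high)
    next
      case (4 G F E)
      from 4(2-) show ?case by (rule 4(1))
    qed
    have col0: "empty_box n \<pi> 0 G (\<pi> E) (\<pi> F)"
      using q0 unfolding empty_box_def by blast
    have col1: "empty_box n \<pi> G F d t" if "t \<le> \<pi> E \<or> \<pi> F \<le> d" for d t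
      unfolding empty_box_def
    proof (rule notI, elim bexE conjE)
      fix x assume "G < x" "x < F" "d < \<pi> x" "\<pi> x < t"
      with q1[of x] that show False by linarith
    qed
    have col2: "empty_box n \<pi> F E d t" if "\<pi> G \<le> d" for d t
      unfolding empty_box_def
    proof (rule notI, elim bexE conjE)
      fix x assume "F < x" "x < E" "d < \<pi> x"
      with q2[of x] that show False by linarith
    qed
    have "empty_box n \<pi> G F 0 (\<pi> G)" "empty_box n \<pi> G F (\<pi> G) (\<pi> E)"
      "empty_box n \<pi> G F (\<pi> F) (n + 1)"
      using q(5) by (auto intro: col1)
    moreover have "empty_box n \<pi> F E (\<pi> G) (\<pi> E)" "empty_box n \<pi> F E (\<pi> E) (\<pi> F)"
      "empty_box n \<pi> F E (\<pi> F) (n + 1)"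
      using q(5,6) by (auto intro: col2)
    moreover have "1 \<le> G" "E \<le> n"
      using q pos by auto
    ultimately show ?thesis
      unfolding q_iff using q col0 by blast
  qed
qed

section \<open>Coincidence\<close>

lemma mesh_contains_mono:
  assumes "R \<subseteq> R'" and "mesh_contains n \<pi> (k, \<tau>, R')"
  shows "mesh_contains n \<pi> (k, \<tau>, R)"
proof -
  obtain u v where occ: "mesh_occurrence n \<pi> (k, \<tau>, R') u v"
    using assms(2) unfolding mesh_contains_def by blast
  have "mesh_occurrence n \<pi> (k, \<tau>, R) u v"
    unfolding mesh_occurrence.simps
  proof (intro conjI, goal_cases)
    case 10
    show ?case
    proof
      fix r assume "r \<in> R"
      with assms(1) have "r \<in> R'" by blast
      with occ show "case r of (a, b) \<Rightarrow>
          \<not> (\<exists>x\<in>{1..n}. u a < x \<and> x < u (a + 1) \<and> v b < \<pi> x \<and> \<pi> x < v (b + 1))"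
        unfolding mesh_occurrence.simps by (elim conjE) (rule bspec)
    qed
  qed (use occ in simp_all)
  then show ?thesis unfolding mesh_contains_def by blast
qed

theorem proposition3p5:
  shows "coincident pattern_p pattern_q"
proof -
  have "mesh_contains n \<pi> pattern_p" if "mesh_contains n \<pi> pattern_q" for n \<pi>
    using that unfolding pattern_p_def pattern_q_def by (rule mesh_contains_mono[rotated]) simp
  then show ?thesis
    using mesh_contains_p_imp_q unfolding coincident_def mesh_avoids_def by blast
qed

end
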